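(* Let $P_n$ be the path on $n$ vertices and $C_n$ the cycle on $n$ vertices. If $N$ is an independent set of $P_n$ with $|N|\ge 2$, then $\operatorname{Z}(P_n^{N})=\operatorname{M}(P_n^{N})=|N|$. If $N$ is an independent set of $C_n$ with $|N|\ge 2$, then $\operatorname{Z}(C_n^{N})=\operatorname{M}(C_n^{N})=|N|$.
   Context: Graphs are finite, simple and undirected. For a graph $G$, $\mathcal S(G)$ is the set of real symmetric matrices indexed by $V(G)$ whose off-diagonal $ij$ entry is nonzero if and only if $ij\in E(G)$; diagonal entries are arbitrary. A probe graph $G^{N}$ is a graph $G$ with an independent set $N\subseteq V(G)$ of non-probe vertices; the other vertices are probe vertices. $\mathcal S(G^{N})$ is the union of $\mathcal S(H)$ over all graphs $H$ obtained from $G$ by adding any number of edges between vertices of $N$. $\operatorname{M}(G^{N})$ is the maximum nullity of a matrix in $\mathcal S(G^{N})$. Probe graph color change rule, for a current set $B$ of blue vertices (others white; adjacency is in $G$): (1) if $v\in B$ is a probe vertex with exactly one white neighbor $w$, then $v$ forces $w$ to become blue; (2) if $N\subseteq B$ and $u\in N$ has exactly one white neighbor $w$, then $u$ forces $w$ to become blue. A set of initially blue vertices is a probe graph zero forcing set if repeated application of the rule eventually colors all of $V(G)$ blue. $\operatorname{Z}(G^{N})$ is the minimum cardinality of a probe graph zero forcing set. *)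

theory Defs
  imports "Graph_Theory.Pair_Digraph" "Jordan_Normal_Form.Matrix_Kernel"
begin

text \<open>
  A finite simple undirected graph is a \<open>pair_graph\<close>: a finite loop-free digraph without
  parallel arcs whose arc relation is symmetric, the edge \<open>uv\<close> being the arc pair
  \<open>(u, v)\<close>, \<open>(v, u)\<close>.
\<close>

definition path_graph :: "nat \<Rightarrow> nat pair_pre_digraph" where
  "path_graph n = \<lparr> pverts = {..<n},
     parcs = {(i, j). i < n \<and> j < n \<and> (j = i + 1 \<or> i = j + 1)} \<rparr>"

text \<open>The cycle is meaningful only for \<open>n \<ge> 3\<close>: for \<open>n = 1\<close> the formula gives a loop, for
  \<open>n = 2\<close> a single edge.\<close>

definition cycle_graph :: "nat \<Rightarrow> nat pair_pre_digraph" where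
  "cycle_graph n = \<lparr> pverts = {..<n},
     parcs = {(i, j). i < n \<and> j < n \<and> (j = (i + 1) mod n \<or> i = (j + 1) mod n)} \<rparr>"

definition independent_set :: "'a pair_pre_digraph \<Rightarrow> 'a set \<Rightarrow> bool" where
  "independent_set G N \<longleftrightarrow> N \<subseteq> pverts G \<and> (\<forall>u\<in>N. \<forall>v\<in>N. (u, v) \<notin> parcs G)"

text \<open>Matrices in \<open>mat\<close> have rows and columns numbered from \<open>0\<close>, so this definition is meant for
  graphs \<open>G\<close> with \<open>pverts G = {..<n}\<close> for some \<open>n\<close>; then \<open>n = card (pverts G)\<close>.\<close>

definition graph_matrices :: "nat pair_pre_digraph \<Rightarrow> real mat set" where
  "graph_matrices G = {A \<in> carrier_mat (card (pverts G)) (card (pverts G)).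
     transpose_mat A = A \<and>
     (\<forall>i\<in>pverts G. \<forall>j\<in>pverts G. i \<noteq> j \<longrightarrow> (A $$ (i, j) \<noteq> 0 \<longleftrightarrow> (i, j) \<in> parcs G))}"

definition probe_completions :: "'a pair_pre_digraph \<Rightarrow> 'a set \<Rightarrow> 'a pair_pre_digraph set" where
  "probe_completions G N = {H. pair_graph H \<and> pverts H = pverts G \<and>
     parcs G \<subseteq> parcs H \<and> parcs H - parcs G \<subseteq> N \<times> N}"

definition probe_matrices :: "nat pair_pre_digraph \<Rightarrow> nat set \<Rightarrow> real mat set" where
  "probe_matrices G N = (\<Union>H\<in>probe_completions G N. graph_matrices H)"

definition probe_max_nullity :: "nat pair_pre_digraph \<Rightarrow> nat set \<Rightarrow> nat" where
  "probe_max_nullity G N = Max (kernel_dim ` probe_matrices G N)"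

definition white_neighbors :: "'a pair_pre_digraph \<Rightarrow> 'a set \<Rightarrow> 'a \<Rightarrow> 'a set" where
  "white_neighbors G B v = {w \<in> pverts G. (v, w) \<in> parcs G \<and> w \<notin> B}"

text \<open>A single force, taking the blue set \<open>B\<close> to \<open>insert w B\<close>.\<close>

inductive probe_color_change :: "'a pair_pre_digraph \<Rightarrow> 'a set \<Rightarrow> 'a set \<Rightarrow> 'a set \<Rightarrow> bool"
  for G :: "'a pair_pre_digraph" and N :: "'a set" where
  probe: "v \<in> B \<Longrightarrow> v \<notin> N \<Longrightarrow> white_neighbors G B v = {w} \<Longrightarrow>
    probe_color_change G N B (insert w B)"
| nonprobe: "N \<subseteq> B \<Longrightarrow> u \<in> N \<Longrightarrow> white_neighbors G B u = {w} \<Longrightarrow>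
    probe_color_change G N B (insert w B)"

definition probe_zero_forcing_set :: "'a pair_pre_digraph \<Rightarrow> 'a set \<Rightarrow> 'a set \<Rightarrow> bool" where
  "probe_zero_forcing_set G N B \<longleftrightarrow>
     B \<subseteq> pverts G \<and> (probe_color_change G N)\<^sup>*\<^sup>* B (pverts G)"

definition probe_zero_forcing_number :: "'a pair_pre_digraph \<Rightarrow> 'a set \<Rightarrow> nat" where
  "probe_zero_forcing_number G N = Min (card ` {B. probe_zero_forcing_set G N B})"

lemma pair_graph_path_graph: "pair_graph (path_graph n)"
proof -
  have "finite {(i, j). i < n \<and> j < n \<and> (j = i + 1 \<or> i = j + 1)}"
    by (rule finite_subset[of _ "{..<n} \<times> {..<n}"]) auto
  then show ?thesis
    by unfold_locales (auto simp: path_graph_def symmetric_def intro!: symI)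
qed

lemma pair_graph_cycle_graph:
  assumes "n \<ge> 3"
  shows "pair_graph (cycle_graph n)"
proof -
  have "finite {(i, j). i < n \<and> j < n \<and> (j = (i + 1) mod n \<or> i = (j + 1) mod n)}"
    by (rule finite_subset[of _ "{..<n} \<times> {..<n}"]) auto
  moreover have "Suc i mod n \<noteq> i" "i \<noteq> Suc i mod n" if "i < n" for i
    using assms that by (cases "Suc i = n"; auto)+
  ultimately show ?thesis
    by unfold_locales (auto simp: cycle_graph_def symmetric_def intro!: symI)
qed

text \<open>The sets under \<open>Max\<close> and \<open>Min\<close> above are finite and nonempty.\<close>

lemma finite_probe_nullities: "finite (kernel_dim ` probe_matrices G N)"
proof (rule finite_subset)
  show "kernel_dim ` probe_matrices G N \<subseteq> {..card (pverts G)}"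
    by (auto simp: probe_matrices_def probe_completions_def graph_matrices_def
        kernel_dim_code)
qed simp

lemma probe_matrices_nonempty:
  assumes "pair_graph G" "pverts G = {..<n}"
  shows "probe_matrices G N \<noteq> {}"
proof -
  interpret pair_graph G by fact
  let ?A = "mat n n (\<lambda>e. if e \<in> parcs G then 1 else 0) :: real mat"
  have "(i, j) \<in> parcs G \<longleftrightarrow> (j, i) \<in> parcs G" for i j
    using pair_sym_arcs by (auto simp: symmetric_def dest: symD)
  then have "?A \<in> graph_matrices G"
    using assms(2) by (auto simp: graph_matrices_def)
  moreover have "G \<in> probe_completions G N"
    using assms(1) by (simp add: probe_completions_def)
  ultimately show ?thesis
    unfolding probe_matrices_def by blast
qed

lemma finite_probe_zero_forcing_sets:
  "finite (pverts G) \<Longrightarrow> finite {B. probe_zero_forcing_set G N B}"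
  by (rule finite_subset[of _ "Pow (pverts G)"]) (auto simp: probe_zero_forcing_set_def)

lemma probe_zero_forcing_set_pverts: "probe_zero_forcing_set G N (pverts G)"
  by (simp add: probe_zero_forcing_set_def)

end

theory Submission
  imports Defs "Jordan_Normal_Form.Char_Poly"
begin

text \<open>
  Three inequalities close a circle: \<open>|N| \<le> M(G\<^sup>N) \<le> Z(G\<^sup>N) \<le> |N|\<close>. The first holds for every independent
  set \<open>N\<close> of every graph \<open>G\<close>, the second for every probe graph; only the third uses that \<open>G\<close> is a
  path or a cycle.

  \<^item> \<open>|N| \<le> M\<close>: Since edges inside \<open>N\<close> may be added at will, the \<open>N \<times> N\<close> block of a matrix in
    \<open>S(G\<^sup>N)\<close> is an arbitrary symmetric matrix. Choose the probe block \<open>D\<close> invertible, by shifting its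
    diagonal, keep any mixed block \<open>C\<close> with the right pattern, and let the \<open>N \<times> N\<close> block be
    \<open>C\<^sup>T D\<^sup>-\<^sup>1 C\<close>. The Schur complement of \<open>D\<close> is then zero, so the rank is the number of probe vertices
    and the nullity is \<open>|N|\<close> (\<open>exists_nullity_ge_card_nonprobes\<close>).

  \<^item> \<open>M \<le> Z\<close>: Let a kernel vector vanish on the blue vertices. If \<open>v\<close> forces \<open>w\<close>, then row \<open>v\<close> of
    \<open>A x = 0\<close> has the single term \<open>A\<^sub>v\<^sub>w x\<^sub>w\<close> left, so the vector vanishes at \<open>w\<close> as well; the condition
    \<open>N \<subseteq> B\<close> in the rule for nonprobes takes care of the unknown edges inside \<open>N\<close>. Hence a kernel
    vector that vanishes on a forcing set is zero (\<open>nullity_le_card_forcing_set\<close>).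

  \<^item> \<open>Z \<le> |N|\<close>: Traverse the path or cycle, starting at an end of the path or at a vertex of \<open>N\<close> on
    the cycle. Each vertex forces its successor, and this is stopped only by a nonprobe that is
    reached before \<open>N\<close> is entirely blue. So the blue set consists of the starting vertices and of \<open>N\<close>
    with one vertex omitted, namely the first vertex of \<open>N\<close> that the traversal has to pass: on arrival
    there, \<open>N\<close> is blue (\<open>path_forcing_set\<close>, \<open>cycle_forcing_set\<close>).
\<close>

section \<open>Bounds on the dimension of a matrix kernel\<close>

context kernel
begin

text \<open>Kernel vectors that restrict to unit vectors on \<open>N\<close> are linearly independent: coordinate \<open>v\<close> of
  a linear combination reads off the coefficient of \<open>x v\<close>.\<close>

lemma card_le_kernel_dim:
  assumes N: "N \<subseteq> {..<nc}"
    and x: "\<And>v. v \<in> N \<Longrightarrow> x v \<in> mat_kernel A"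
    and unit: "\<And>u v. u \<in> N \<Longrightarrow> v \<in> N \<Longrightarrow> x v $ u = (if u = v then 1 else 0)"
  shows "card N \<le> kernel_dim A"
proof -
  have inj: "inj_on x N"
    by (rule inj_onI) (metis unit zero_neq_one)
  have fin: "finite (x ` N)"
    using N finite_subset by blast
  have sub: "x ` N \<subseteq> mat_kernel A"
    using x by auto
  have "Ker.lin_indpt (x ` N)"
  proof (rule Ker.finite_lin_indpt2)
    show "finite (x ` N)" by fact
    show "x ` N \<subseteq> mat_kernel A" by fact
    fix a :: "'a vec \<Rightarrow> 'a"
    assume lc: "Ker.lincomb a (x ` N) = 0\<^sub>v nc"
    show "\<forall>w\<in>x ` N. a w = 0"
    proof (rule ballI)
      fix w assume "w \<in> x ` N"
      then obtain v where v: "v \<in> N" "w = x v" by blast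
      have "Ker.lincomb a (x ` N) $ v = (\<Sum>u\<in>N. a (x u) * x u $ v)"
        using lincomb_index[OF _ sub] v N inj by (auto simp: sum.reindex)
      also have "\<dots> = (\<Sum>u\<in>N. if u = v then a (x u) else 0)"
        using v by (intro sum.cong) (auto simp: unit)
      also have "\<dots> = a (x v)"
        using v N finite_subset[OF N] by (simp add: sum.delta')
      finally show "a w = 0"
        using lc v N by (auto simp: class_ring_simps)
    qed
  qed
  moreover have "Ker.fin_dim"
    using kernel_basis_exists[OF A] unfolding Ker.fin_dim_def Ker.basis_def by auto
  ultimately have "card (x ` N) \<le> dim"
    using Ker.li_le_dim(2) sub by blast
  then show ?thesis
    by (simp add: card_image[OF inj])
qed

text \<open>The hypothesis says that the kernel meets the coordinate subspace of vectors vanishing on \<open>B\<close>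
  only in zero. That subspace has dimension \<open>nc - card B\<close>, so a basis of the kernel together with
  the unit vectors off \<open>B\<close> is still independent in a space of dimension \<open>nc\<close>.\<close>

lemma kernel_dim_le_card:
  assumes B: "B \<subseteq> {..<nc}"
    and vanish: "\<And>x. x \<in> mat_kernel A \<Longrightarrow> (\<And>b. b \<in> B \<Longrightarrow> x $ b = 0) \<Longrightarrow> x = 0\<^sub>v nc"
  shows "kernel_dim A \<le> card B"
proof -
  obtain K where fK: "finite K" and K: "basis K"
    using kernel_basis_exists[OF A] by blast
  have KA: "K \<subseteq> mat_kernel A" and Kli: "NC.lin_indpt K"
    using K lindep_same unfolding Ker.basis_def by auto
  have KC: "K \<subseteq> carrier_vec nc"
    using KA mat_kernel_carrier[OF A] by blast
  define U where "U = (unit_vec nc ` ({..<nc} - B) :: 'a vec set)"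
  have fU: "finite U" and UC: "U \<subseteq> carrier_vec nc"
    by (auto simp: U_def)
  have inj: "inj_on (unit_vec nc :: nat \<Rightarrow> 'a vec) ({..<nc} - B)"
    by (rule inj_onI) (metis DiffE index_unit_vec(1) lessThan_iff zero_neq_one)
  have U0: "u $ b = 0" if "u \<in> U" "b \<in> B" for u b
    using that B by (auto simp: U_def)
  have "(UNIV :: 'a set) \<noteq> {0}"
    by (metis UNIV_I one_neq_zero singletonD)
  then have "0\<^sub>v nc \<notin> K"
    using Kli KC NC.zero_nin_lin_indpt[of K] by auto
  then have disj: "K \<inter> U = {}"
    using vanish U0 KA by blast
  have KUC: "K \<union> U \<subseteq> carrier_vec nc"
    using KC UC by auto
  have "NC.lin_indpt (K \<union> U)"
  proof (rule NC.finite_lin_indpt2)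
    show "finite (K \<union> U)" "K \<union> U \<subseteq> carrier_vec nc"
      using fK fU KUC by auto
    fix a :: "'a vec \<Rightarrow> 'a"
    assume lc: "NC.lincomb a (K \<union> U) = 0\<^sub>v nc"
    have coord: "(\<Sum>x\<in>K. a x * x $ i) + (\<Sum>x\<in>U. a x * x $ i) = 0" if "i < nc" for i
      using NC.lincomb_index[OF that KUC, of a] lc that disj fK fU
      by (simp add: sum.union_disjoint)
    have Ker: "NC.lincomb a K \<in> mat_kernel A"
      using Ker.lincomb_closed[OF KA, of a] lincomb_same[OF KA, of a] by auto
    have "NC.lincomb a K = 0\<^sub>v nc"
    proof (rule vanish[OF Ker])
      fix b assume b: "b \<in> B"
      then have "b < nc" using B by auto
      moreover have "(\<Sum>x\<in>U. a x * x $ b) = 0"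
        using U0 b by (intro sum.neutral) auto
      ultimately show "NC.lincomb a K $ b = 0"
        using coord[of b] NC.lincomb_index[of b K a] KC by simp
    qed
    then have aK: "\<forall>v\<in>K. a v = 0"
      using Kli fK unfolding NC.lin_dep_def by (auto simp: class_ring_simps)
    have "a u = 0" if u: "u \<in> U" for u
    proof -
      obtain i where i: "i < nc" "i \<notin> B" "u = unit_vec nc i"
        using u by (auto simp: U_def)
      have "0 = (\<Sum>x\<in>U. a x * x $ i)"
        using coord[OF i(1)] aK by simp
      also have "\<dots> = (\<Sum>j\<in>{..<nc} - B. a (unit_vec nc j) * unit_vec nc j $ i)"
        unfolding U_def by (simp add: sum.reindex[OF inj])
      also have "\<dots> = (\<Sum>j\<in>{..<nc} - B. if j = i then a (unit_vec nc j) else 0)"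
        using i by (intro sum.cong) auto
      also have "\<dots> = a u"
        using i by (simp add: sum.delta')
      finally show ?thesis by simp
    qed
    with aK show "\<forall>v\<in>K \<union> U. a v = 0" by auto
  qed
  then have "card (K \<union> U) \<le> nc"
    using NC.li_le_dim(2)[of "K \<union> U"] NC.dim_is_n KUC by simp
  moreover have "card U = nc - card B"
    using B finite_subset[OF B] by (simp add: U_def card_image[OF inj] card_Diff_subset)
  moreover have "card B \<le> nc"
    using card_mono[OF _ B] by simp
  moreover have "kernel_dim A = card K"
    using Ker.dim_basis[OF fK K] by simp
  ultimately show ?thesis
    using card_Un_disjoint[OF fK fU disj] by simp
qed

end

section \<open>Nullity is at most the size of a forcing set\<close>

text \<open>Row \<open>v\<close> of \<open>A x = 0\<close>, for the forcing vertex \<open>v\<close>, isolates the coordinate of the forced vertex. The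
  arcs of \<open>H\<close> beyond those of \<open>G\<close> join two nonprobes: they do not meet \<open>v\<close> if it is a probe, and they
  lead into \<open>N \<subseteq> B\<close> if it is not.\<close>

lemma forcing_step_preserves_vanishing:
  assumes G: "pverts G = {..<n}"
    and H: "H \<in> probe_completions G N" and A: "A \<in> graph_matrices H"
    and x: "x \<in> mat_kernel A"
    and step: "probe_color_change G N B B'"
    and B: "B \<subseteq> {..<n}" "\<And>b. b \<in> B \<Longrightarrow> x $ b = 0"
  shows "B' \<subseteq> {..<n} \<and> (\<forall>b\<in>B'. x $ b = 0)"
proof -
  have GH: "pverts H = {..<n}" "parcs G \<subseteq> parcs H" "parcs H - parcs G \<subseteq> N \<times> N"
    using H G by (auto simp: probe_completions_def)
  have An: "A \<in> carrier_mat n n"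
    and pat: "\<And>i j. i < n \<Longrightarrow> j < n \<Longrightarrow> i \<noteq> j \<Longrightarrow> A $$ (i, j) \<noteq> 0 \<longleftrightarrow> (i, j) \<in> parcs H"
    using A GH(1) by (auto simp: graph_matrices_def)
  have xn: "x \<in> carrier_vec n" and Ax: "A *\<^sub>v x = 0\<^sub>v n"
    using mat_kernelD[OF An x] by auto
  have forced: "x $ w = 0 \<and> w < n"
    if v: "v \<in> B" and w: "white_neighbors G B v = {w}"
      and nbrs: "\<And>u. (v, u) \<in> parcs H \<Longrightarrow> (v, u) \<in> parcs G \<or> u \<in> B" for v w
  proof -
    have vn: "v < n" using v B by auto
    have wn: "w < n" and wB: "w \<notin> B" and vw: "(v, w) \<in> parcs G"
      using w G by (auto simp: white_neighbors_def)
    \<comment> \<open>The diagonal term \<open>j = v\<close> vanishes because \<open>v\<close> itself is blue.\<close>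
    have zero: "A $$ (v, j) * x $ j = 0" if j: "j < n" "j \<noteq> w" for j
    proof (cases "j \<in> B")
      case False
      then have "(v, j) \<notin> parcs G"
        using w j G by (auto simp: white_neighbors_def)
      then have "(v, j) \<notin> parcs H" using nbrs False by blast
      then show ?thesis using pat[OF vn j(1)] v False by auto
    qed (simp add: B)
    have "0 = (A *\<^sub>v x) $ v" using Ax vn by simp
    also have "\<dots> = (\<Sum>j<n. A $$ (v, j) * x $ j)"
      using An xn vn by (simp add: scalar_prod_def lessThan_atLeast0)
    also have "\<dots> = A $$ (v, w) * x $ w"
      using zero wn by (subst sum.remove[of _ w]) (auto intro!: sum.neutral dest: zero)
    finally have "A $$ (v, w) * x $ w = 0" by simp
    moreover have "A $$ (v, w) \<noteq> 0"
      using pat[OF vn wn] vw GH(2) wB v by auto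
    ultimately show ?thesis using wn by simp
  qed
  from step show ?thesis
  proof cases
    case (probe v w)
    then have "x $ w = 0 \<and> w < n"
      using forced[of v w] GH(3) by auto
    then show ?thesis using probe B by auto
  next
    case (nonprobe u w)
    then have "x $ w = 0 \<and> w < n"
      using forced[of u w] GH(3) by auto
    then show ?thesis using nonprobe B by auto
  qed
qed

lemma nullity_le_card_forcing_set:
  assumes G: "pverts G = {..<n}"
    and A: "A \<in> probe_matrices G N"
    and B: "probe_zero_forcing_set G N B"
  shows "kernel_dim A \<le> card B"
proof -
  obtain H where H: "H \<in> probe_completions G N" and AH: "A \<in> graph_matrices H"
    using A by (auto simp: probe_matrices_def)
  have An: "A \<in> carrier_mat n n"
    using H AH G by (auto simp: probe_completions_def graph_matrices_def)
  interpret kernel n n A by unfold_locales (rule An)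
  have Bn: "B \<subseteq> {..<n}" and run: "(probe_color_change G N)\<^sup>*\<^sup>* B {..<n}"
    using B G by (auto simp: probe_zero_forcing_set_def)
  show ?thesis
  proof (rule kernel_dim_le_card[OF Bn])
    fix x assume x: "x \<in> mat_kernel A" and x0: "\<And>b. b \<in> B \<Longrightarrow> x $ b = 0"
    have "C \<subseteq> {..<n} \<and> (\<forall>b\<in>C. x $ b = 0)"
      if "(probe_color_change G N)\<^sup>*\<^sup>* B C" for C
      using that
    proof (induction rule: rtranclp_induct)
      case base
      then show ?case using Bn x0 by simp
    next
      case (step B1 B2)
      then show ?case
        using forcing_step_preserves_vanishing[OF G H AH x step.hyps(2)] by simp
    qed
    from this[OF run] have "\<forall>b\<in>{..<n}. x $ b = 0" by simp
    then show "x = 0\<^sub>v n"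
      using mat_kernelD(1)[OF An x] by (intro eq_vecI) auto
  qed
qed

section \<open>The matrix realising nullity \<open>|N|\<close>\<close>

text \<open>The characteristic polynomial has finitely many roots, so some nonzero shift of the diagonal makes a
  matrix invertible. (\<open>char_matrix A e\<close> is \<open>A - e I\<close>.)\<close>

lemma exists_solvable_shift:
  fixes A :: "real mat"
  assumes A: "A \<in> carrier_mat n n"
  obtains e where "e \<noteq> 0"
    and "\<And>b. b \<in> carrier_vec n \<Longrightarrow> \<exists>z\<in>carrier_vec n. char_matrix A e *\<^sub>v z = b"
proof -
  have "char_poly A \<noteq> 0"
    using degree_monic_char_poly[OF A] by auto
  then have "finite ({e. poly (char_poly A) e = 0} \<union> {0})"
    by (simp add: poly_roots_finite)
  then obtain e where "e \<notin> {e. poly (char_poly A) e = 0} \<union> {0}"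
    using ex_new_if_finite[OF infinite_UNIV_char_0] by blast
  then have e: "e \<noteq> 0" "poly (char_poly A) e \<noteq> 0" by auto
  have C: "char_matrix A e \<in> carrier_mat n n"
    using A by simp
  have "det (char_matrix A e) \<noteq> 0"
    using e A eigenvalue_det eigenvalue_root_char_poly by metis
  from det_non_zero_imp_unit[OF C this, of "()"]
  obtain D where D: "D \<in> carrier_mat n n" "char_matrix A e * D = 1\<^sub>m n"
    unfolding Units_def ring_mat_def by auto
  show thesis
  proof (rule that[OF e(1)])
    fix b :: "real vec" assume b: "b \<in> carrier_vec n"
    then have "char_matrix A e *\<^sub>v (D *\<^sub>v b) = b"
      using assoc_mult_mat_vec[OF C D(1) b] D(2) by simp
    then show "\<exists>z\<in>carrier_vec n. char_matrix A e *\<^sub>v z = b"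
      using D(1) b by (meson mult_mat_vec_carrier)
  qed
qed


text \<open>For each nonprobe \<open>v\<close> the vector \<open>e\<^sub>v - D\<^sup>-\<^sup>1 C e\<^sub>v\<close> lies in the kernel of the matrix with zero
  Schur complement. The proof works with \<open>z v = - D\<^sup>-\<^sup>1 C e\<^sub>v\<close>, the solution of a linear system, instead
  of with blocks and inverses. To keep the row and column indices of \<open>G\<close>, \<open>D\<close> is padded on \<open>N\<close> by the
  diagonal \<open>-e\<close>, and \<open>e \<noteq> 0\<close> makes \<open>z v\<close> vanish on \<open>N\<close>.\<close>

lemma exists_nullity_ge_card_nonprobes:
  assumes pg: "pair_graph G" and G: "pverts G = {..<n}" and ind: "independent_set G N"
  shows "\<exists>A\<in>probe_matrices G N. card N \<le> kernel_dim A"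
proof -
  interpret pair_graph G by fact
  have Nn: "N \<subseteq> {..<n}" and indN: "\<And>u v. u \<in> N \<Longrightarrow> v \<in> N \<Longrightarrow> (u, v) \<notin> parcs G"
    using ind G by (auto simp: independent_set_def)
  have sym: "(i, j) \<in> parcs G \<longleftrightarrow> (j, i) \<in> parcs G" for i j
    using pair_sym_arcs by (auto simp: symmetric_def dest: symD)
  define a :: "nat \<Rightarrow> nat \<Rightarrow> real" where "a i j = of_bool ((i, j) \<in> parcs G)" for i j
  have a_sym: "a i j = a j i" for i j
    by (simp add: a_def sym)
  have aN: "a u v = 0" if "u \<in> N" "v \<in> N" for u v
    using indN that by (simp add: a_def)
  define A0 where "A0 = mat n n (\<lambda>(i, j). if i \<in> N \<or> j \<in> N then 0 else a i j)"
  have A0: "A0 \<in> carrier_mat n n" by (simp add: A0_def)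
  obtain e where e: "e \<noteq> 0"
    and solve: "\<And>b. b \<in> carrier_vec n \<Longrightarrow> \<exists>z\<in>carrier_vec n. char_matrix A0 e *\<^sub>v z = b"
    using exists_solvable_shift[OF A0] by blast
  \<comment> \<open>The entries of \<open>char_matrix A0 e\<close>: the probe block \<open>D\<close>, padded on \<open>N\<close>.\<close>
  define d where "d i j = (if i \<in> N \<or> j \<in> N then 0 else a i j) - (if i = j then e else 0)" for i j
  have d_sym: "d i j = d j i" for i j
    by (simp add: d_def a_sym disj_commute)
  obtain z where zn: "\<And>v. z v \<in> carrier_vec n"
    and z: "\<And>v. char_matrix A0 e *\<^sub>v z v = vec n (\<lambda>i. - a i v)"
    using solve[of "vec n (\<lambda>i. - a i v)" for v] by (metis vec_carrier)
  have dz: "(\<Sum>j<n. d i j * z v $ j) = - a i v" if i: "i < n" for i v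
  proof -
    have "- a i v = (char_matrix A0 e *\<^sub>v z v) $ i"
      using z i by simp
    also have "\<dots> = (\<Sum>j<n. char_matrix A0 e $$ (i, j) * z v $ j)"
      using A0 zn[of v] i
      by (auto simp: scalar_prod_def lessThan_atLeast0 char_matrix_def intro!: sum.cong)
    also have "\<dots> = (\<Sum>j<n. d i j * z v $ j)"
      using i by (intro sum.cong) (auto simp: char_matrix_def A0_def d_def)
    finally show ?thesis by simp
  qed
  have zN: "z v $ u = 0" if "u \<in> N" "v \<in> N" for u v
  proof -
    have "(\<Sum>j<n. d u j * z v $ j) = (\<Sum>j<n. if j = u then - e * z v $ j else 0)"
      using that by (intro sum.cong) (auto simp: d_def)
    also have "\<dots> = - e * z v $ u"
      using that Nn by (auto simp: sum.delta')
    finally show ?thesis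
      using dz[of u v] aN that Nn e by auto
  qed
  \<comment> \<open>\<open>s\<close> is \<open>- C\<^sup>T D\<^sup>-\<^sup>1 C\<close>, whose symmetry comes from that of \<open>D\<close>.\<close>
  define s where "s u v = (\<Sum>k<n. a u k * z v $ k)" for u v
  have s_dz: "s u v = - (\<Sum>k<n. \<Sum>j<n. z v $ k * d k j * z u $ j)" for u v
  proof -
    have "s u v = (\<Sum>k<n. - ((\<Sum>j<n. d k j * z u $ j) * z v $ k))"
      unfolding s_def by (intro sum.cong) (auto simp: dz a_sym)
    then show ?thesis
      by (simp add: sum_negf sum_distrib_left mult_ac)
  qed
  have s_sym: "s u v = s v u" for u v
    unfolding s_dz by (subst sum.swap) (simp add: mult_ac d_sym)
  define A where "A = mat n n (\<lambda>(i, j). if i \<in> N \<and> j \<in> N then - s i j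
    else a i j - (if i = j then e else 0))"
  have An: "A \<in> carrier_mat n n" by (simp add: A_def)
  \<comment> \<open>The completion of \<open>G\<close> is dictated by the nonzero entries of \<open>s\<close> off the diagonal.\<close>
  define H where "H = \<lparr>pverts = {..<n},
    parcs = parcs G \<union> {(u, v). u \<in> N \<and> v \<in> N \<and> u \<noteq> v \<and> s u v \<noteq> 0}\<rparr>"
  have fN: "finite N" using Nn finite_subset by blast
  have "finite {(u, v). u \<in> N \<and> v \<in> N \<and> u \<noteq> v \<and> s u v \<noteq> 0}"
    by (rule finite_subset[of _ "N \<times> N"]) (auto simp: fN)
  moreover have "finite (parcs G)" by simp
  ultimately have "finite (parcs H)" by (simp add: H_def)
  moreover have "fst h \<in> {..<n} \<and> snd h \<in> {..<n} \<and> fst h \<noteq> snd h" if "h \<in> parcs H" for h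
    using that Nn G arc_fst_in_verts arc_snd_in_verts pair_no_loops by (auto simp: H_def)
  moreover have "(v, u) \<in> parcs H" if "(u, v) \<in> parcs H" for u v
    using that sym s_sym by (auto simp: H_def)
  ultimately have "pair_graph H"
    by unfold_locales (auto simp: H_def symmetric_def intro!: symI)
  then have "H \<in> probe_completions G N"
    by (auto simp: probe_completions_def H_def G)
  moreover have "A \<in> graph_matrices H"
    unfolding graph_matrices_def
  proof (intro CollectI conjI ballI impI)
    show "A \<in> carrier_mat (card (pverts H)) (card (pverts H))"
      using An by (simp add: H_def)
    show "A\<^sup>T = A"
      by (rule eq_matI) (auto simp: A_def s_sym a_sym)
    fix i j assume "i \<in> pverts H" "j \<in> pverts H" "i \<noteq> j"
    then show "A $$ (i, j) \<noteq> 0 \<longleftrightarrow> (i, j) \<in> parcs H"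
      using indN by (auto simp: A_def H_def a_def)
  qed
  ultimately have mem: "A \<in> probe_matrices G N"
    by (auto simp: probe_matrices_def)
  define x where "x v = vec n (\<lambda>i. z v $ i + (if i = v then 1 else 0))" for v
  interpret kernel n n A by unfold_locales (rule An)
  have "card N \<le> kernel_dim A"
  proof (rule card_le_kernel_dim[OF Nn])
    show "x v $ u = (if u = v then 1 else 0)" if "u \<in> N" "v \<in> N" for u v
      using that Nn zN by (auto simp: x_def)
    fix v assume v: "v \<in> N"
    then have vn: "v < n" using Nn by auto
    show "x v \<in> mat_kernel A"
    proof (rule mat_kernelI[OF An])
      show "x v \<in> carrier_vec n" by (simp add: x_def)
      show "A *\<^sub>v x v = 0\<^sub>v n"
      proof (rule eq_vecI)
        fix i assume "i < dim_vec (0\<^sub>v n :: real vec)"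
        then have i: "i < n" by simp
        have "(A *\<^sub>v x v) $ i = (\<Sum>j<n. A $$ (i, j) * (z v $ j + (if j = v then 1 else 0)))"
          using An i by (auto simp: scalar_prod_def lessThan_atLeast0 x_def)
        also have "\<dots> = (\<Sum>j<n. A $$ (i, j) * z v $ j)
            + (\<Sum>j<n. if j = v then A $$ (i, j) else 0)"
          unfolding sum.distrib[symmetric] by (intro sum.cong) (auto simp: distrib_left)
        also have "(\<Sum>j<n. if j = v then A $$ (i, j) else 0) = A $$ (i, v)"
          using vn by (simp add: sum.delta')
        also have "(\<Sum>j<n. A $$ (i, j) * z v $ j) = - A $$ (i, v)"
        proof (cases "i \<in> N")
          case True
          have "(\<Sum>j<n. A $$ (i, j) * z v $ j) = s i v"
            unfolding s_def using True i zN v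
            by (intro sum.cong) (auto simp: A_def)
          then show ?thesis using True v vn i by (simp add: A_def)
        next
          case False
          have "(\<Sum>j<n. A $$ (i, j) * z v $ j) = (\<Sum>j<n. d i j * z v $ j)"
            using False i zN v by (intro sum.cong) (auto simp: A_def d_def)
          then show ?thesis using False v vn i dz by (auto simp: A_def)
        qed
        finally show "(A *\<^sub>v x v) $ i = 0\<^sub>v n $ i" using i by simp
      qed (use An in simp)
    qed
  qed
  with mem show ?thesis by blast
qed

text \<open>Reduces both equalities to exhibiting a forcing set of size \<open>|N|\<close>: with the matrix of nullity at
  least \<open>|N|\<close> just constructed, the chain \<open>|N| \<le> M \<le> Z \<le> |N|\<close> collapses.\<close>

lemma probe_numbers_eq_card_nonprobesI:
  assumes pg: "pair_graph G" and G: "pverts G = {..<n}" and ind: "independent_set G N"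
    and B: "probe_zero_forcing_set G N B" "card B = card N"
  shows "probe_zero_forcing_number G N = card N \<and> probe_max_nullity G N = card N"
proof -
  obtain A where A: "A \<in> probe_matrices G N" "card N \<le> kernel_dim A"
    using exists_nullity_ge_card_nonprobes[OF pg G ind] by blast
  note upper = nullity_le_card_forcing_set[OF G]
  have "kernel_dim A = card N"
    using A upper[OF A(1) B(1)] B(2) by simp
  then have "probe_max_nullity G N = card N"
    unfolding probe_max_nullity_def
    using finite_probe_nullities upper B A(1) by (intro Max_eqI) force+
  moreover have "probe_zero_forcing_number G N = card N"
    unfolding probe_zero_forcing_number_def
  proof (rule Min_eqI)
    show "finite (card ` {B. probe_zero_forcing_set G N B})"
      using finite_probe_zero_forcing_sets[of G N] G by simp
    show "card N \<in> card ` {B. probe_zero_forcing_set G N B}"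
      using B by (metis imageI mem_Collect_eq)
    fix k assume "k \<in> card ` {B. probe_zero_forcing_set G N B}"
    then show "card N \<le> k"
      using upper[OF A(1)] A(2) by force
  qed
  ultimately show ?thesis by simp
qed

section \<open>Forcing sets of paths and cycles\<close>

text \<open>Blueness spreads along the enumeration \<open>f\<close>: by \<open>nbrs\<close> the only neighbour of \<open>f i\<close> that can still be
  white is \<open>f (Suc i)\<close>, and by \<open>nonprobes\<close> the rule for nonprobes is available whenever \<open>f i\<close> needs it.
  The start \<open>s\<close> is \<open>0\<close> on a path. On a cycle it is \<open>1\<close>, since the vertex \<open>f 0\<close> has two neighbours ahead
  of it, \<open>f 1\<close> and \<open>f (n - 1)\<close>, and so must not be asked to force.\<close>

lemma forcing_along_walk:
  assumes V: "pverts G = f ` {..<n}" and B: "B \<subseteq> pverts G"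
    and start: "s < n" "f ` {..s} \<subseteq> B"
    and arc: "\<And>i. s \<le> i \<Longrightarrow> Suc i < n \<Longrightarrow> (f i, f (Suc i)) \<in> parcs G"
    and nbrs: "\<And>i w. s \<le> i \<Longrightarrow> Suc i < n \<Longrightarrow> (f i, w) \<in> parcs G \<Longrightarrow> w \<in> f ` {..Suc i}"
    and nonprobes: "\<And>i. s \<le> i \<Longrightarrow> Suc i < n \<Longrightarrow> f i \<in> N \<Longrightarrow> N \<subseteq> B \<union> f ` {..i}"
  shows "probe_zero_forcing_set G N B"
proof -
  have "(probe_color_change G N)\<^sup>*\<^sup>* B (B \<union> f ` {..i})" if "s \<le> i" "i < n" for i
    using that
  proof (induction i rule: dec_induct)
    case base
    show ?case unfolding Un_absorb2[OF start(2)] ..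
  next
    case (step i)
    let ?C = "B \<union> f ` {..i}"
    have next_eq: "B \<union> f ` {..Suc i} = insert (f (Suc i)) ?C"
      by (auto simp: atMost_Suc)
    show ?case
    proof (cases "f (Suc i) \<in> ?C")
      case True
      then show ?thesis using step next_eq by (simp add: insert_absorb)
    next
      case False
      have "white_neighbors G ?C (f i) = {f (Suc i)}"
        using False V arc[OF step(1,4)] nbrs[OF step(1,4)] step.prems
        by (fastforce simp: white_neighbors_def atMost_Suc)
      then have "probe_color_change G N ?C (insert (f (Suc i)) ?C)"
        using nonprobes[OF step(1,4)]
        by (cases "f i \<in> N") (auto intro: probe_color_change.intros)
      then show ?thesis
        unfolding next_eq using step by (meson Suc_lessD rtranclp.rtrancl_into_rtrancl)
    qed
  qed
  from this[of "n - 1"] have "(probe_color_change G N)\<^sup>*\<^sup>* B (B \<union> f ` {..n - 1})"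
    using start by simp
  moreover have "{..n - 1} = {..<n}" using start(1) by auto
  ultimately show ?thesis
    using V B by (simp add: probe_zero_forcing_set_def Un_absorb1)
qed

text \<open>The traversal runs upwards from the end vertex \<open>0\<close>, and the omitted nonprobe is the least one. It may
  be \<open>0\<close> itself, in which case the forcing set is \<open>N\<close>.\<close>

lemma path_forcing_set:
  assumes ind: "independent_set (path_graph n) N" and ne: "N \<noteq> {}"
  shows "\<exists>B. probe_zero_forcing_set (path_graph n) N B \<and> card B = card N"
proof -
  have Nn: "N \<subseteq> {..<n}" using ind by (simp add: independent_set_def path_graph_def)
  have fN: "finite N" using Nn finite_subset by blast
  define m where "m = Min N"
  have m: "m \<in> N" "\<And>i. i \<in> N \<Longrightarrow> m \<le> i"
    using fN ne by (auto simp: m_def)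
  define B where "B = insert 0 (N - {m})"
  have "probe_zero_forcing_set (path_graph n) N B"
  proof (rule forcing_along_walk[where f = "\<lambda>i. i" and s = 0 and n = n])
    show "B \<subseteq> pverts (path_graph n)" "0 < n"
      using Nn m by (auto simp: B_def path_graph_def)
    show "N \<subseteq> B \<union> (\<lambda>i. i) ` {..i}" if "i \<in> N" for i
      using m(2)[OF that] by (auto simp: B_def)
  qed (auto simp: B_def path_graph_def)
  moreover have "card B = card N"
  proof -
    have "0 \<notin> N - {m}" using m(2)[of 0] by auto
    then show ?thesis
      using fN m(1) card_Suc_Diff1[OF fN m(1)] by (simp add: B_def)
  qed
  ultimately show ?thesis by blast
qed

text \<open>The traversal starts at a nonprobe \<open>v\<close> and its successor, both blue, and the omitted nonprobe is the
  next one after \<open>v\<close>. It differs from \<open>v\<close> because there are two nonprobes. By independence the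
  successor of \<open>v\<close> is a probe, so trading the omitted vertex for it keeps the size.\<close>

lemma cycle_forcing_set:
  assumes n: "n \<ge> 3" and ind: "independent_set (cycle_graph n) N" and two: "card N \<ge> 2"
  shows "\<exists>B. probe_zero_forcing_set (cycle_graph n) N B \<and> card B = card N"
proof -
  have Nn: "N \<subseteq> {..<n}" using ind by (simp add: independent_set_def cycle_graph_def)
  have fN: "finite N" using Nn finite_subset by blast
  obtain v where v: "v \<in> N" using two by fastforce
  then have vn: "v < n" using Nn by auto
  obtain u where u: "u \<in> N" "u \<noteq> v"
    using two card_le_Suc0_iff_eq[OF fN] v by (metis Suc_n_not_le_n le_trans numeral_2_eq_2)
  then have un: "u < n" using Nn by auto
  \<comment> \<open>The vertices in cyclic order, starting at \<open>v\<close>.\<close>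
  define f where "f i = (v + i) mod n" for i
  have surj: "\<exists>i<n. f i = w" if "w < n" for w
  proof (cases "v \<le> w")
    case True
    then show ?thesis using that by (intro exI[of _ "w - v"]) (auto simp: f_def)
  next
    case False
    then show ?thesis using that vn by (intro exI[of _ "w + n - v"]) (auto simp: f_def)
  qed
  have f0: "f 0 = v" using vn by (simp add: f_def)
  have fn: "f i < n" for i using n by (simp add: f_def)
  have f_Suc: "Suc (f i) mod n = f (Suc i)" for i
    by (simp add: f_def mod_Suc_eq)
  have inj: "x = y" if "Suc x mod n = Suc y mod n" "x < n" "y < n" for x y
    using that by (auto simp: mod_Suc split: if_splits)
  have arc: "(f i, f (Suc i)) \<in> parcs (cycle_graph n)" for i
    using fn f_Suc by (simp add: cycle_graph_def)
  obtain k where k: "k > 0" "f k \<in> N"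
    using surj[OF un] u f0 by (metis gr0I)
  define m where "m = (LEAST i. i > 0 \<and> f i \<in> N)"
  have m: "m > 0" "f m \<in> N" and m_le: "\<And>i. i > 0 \<Longrightarrow> f i \<in> N \<Longrightarrow> m \<le> i"
    using LeastI[of "\<lambda>i. i > 0 \<and> f i \<in> N" k] k
    by (auto simp: m_def intro: Least_le)
  have fm: "f m \<noteq> v"
  proof -
    obtain i where i: "i < n" "f i = u" using surj[OF un] by blast
    then have "i > 0" using u f0 by (metis gr0I)
    then have "m \<le> i" using m_le i u by simp
    then show ?thesis using m(1) i vn
      by (auto simp: f_def mod_if split: if_splits)
  qed
  have f1: "f 1 \<notin> N"
    using arc[of 0] ind v f0 by (auto simp: independent_set_def)
  define B where "B = insert (f 1) (N - {f m})"
  have "probe_zero_forcing_set (cycle_graph n) N B"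
  proof (rule forcing_along_walk[where f = f and s = 1 and n = n])
    show "pverts (cycle_graph n) = f ` {..<n}"
      using surj fn by (force simp: cycle_graph_def)
    show "B \<subseteq> pverts (cycle_graph n)"
      using Nn fn by (auto simp: B_def cycle_graph_def)
    show "1 < n" using n by simp
    show "f ` {..1} \<subseteq> B"
      using f0 fm v by (auto simp: B_def atMost_Suc)
    show "(f i, f (Suc i)) \<in> parcs (cycle_graph n)" for i by (rule arc)
    show "w \<in> f ` {..Suc i}" if i: "1 \<le> i" and w: "(f i, w) \<in> parcs (cycle_graph n)" for i w
    proof -
      consider "w = Suc (f i) mod n" | "f i = Suc w mod n" "w < n"
        using w by (auto simp: cycle_graph_def)
      then show ?thesis
      proof cases
        case 1
        then show ?thesis using f_Suc by auto
      next
        case 2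
        then have "Suc w mod n = Suc (f (i - 1)) mod n"
          using f_Suc[of "i - 1"] i by simp
        then have "w = f (i - 1)" using inj 2 fn by blast
        then show ?thesis by auto
      qed
    qed
    show "N \<subseteq> B \<union> f ` {..i}" if "1 \<le> i" "f i \<in> N" for i
      using m_le[of i] that by (auto simp: B_def)
  qed
  moreover have "card B = card N"
    using f1 fN card_Suc_Diff1[OF fN m(2)] by (simp add: B_def)
  ultimately show ?thesis by blast
qed

section \<open>Paths and cycles\<close>

theorem proposition3p6:
  fixes n :: nat and N :: "nat set"
  shows "(independent_set (path_graph n) N \<and> card N \<ge> 2 \<longrightarrow>
            probe_zero_forcing_number (path_graph n) N = card N \<and>
            probe_max_nullity (path_graph n) N = card N) \<and>
         (n \<ge> 3 \<and> independent_set (cycle_graph n) N \<and> card N \<ge> 2 \<longrightarrow>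
            probe_zero_forcing_number (cycle_graph n) N = card N \<and>
            probe_max_nullity (cycle_graph n) N = card N)"
proof -
  have "probe_zero_forcing_number (path_graph n) N = card N \<and>
      probe_max_nullity (path_graph n) N = card N"
    if ind: "independent_set (path_graph n) N" and two: "card N \<ge> 2"
  proof -
    have "N \<noteq> {}" using two by auto
    then obtain B where B: "probe_zero_forcing_set (path_graph n) N B" "card B = card N"
      using path_forcing_set[OF ind] by blast
    show ?thesis
      by (rule probe_numbers_eq_card_nonprobesI[OF pair_graph_path_graph _ ind B])
        (simp add: path_graph_def)
  qed
  moreover have "probe_zero_forcing_number (cycle_graph n) N = card N \<and>
      probe_max_nullity (cycle_graph n) N = card N"
    if n: "n \<ge> 3" and ind: "independent_set (cycle_graph n) N" and two: "card N \<ge> 2"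
  proof -
    obtain B where B: "probe_zero_forcing_set (cycle_graph n) N B" "card B = card N"
      using cycle_forcing_set[OF n ind two] by blast
    show ?thesis
      by (rule probe_numbers_eq_card_nonprobesI[OF pair_graph_cycle_graph[OF n] _ ind B])
        (simp add: cycle_graph_def)
  qed
  ultimately show ?thesis by blast
qed

end
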